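(* Let $G$ be a graph with at least one edge such that, for every maximal clique $C$ of $G$, every vertex of $C$ is an end vertex of some edge occupied by $C$. Then $G$ has an effective competition cover.
   Context: All graphs are finite and simple; digraphs are finite, without loops or multiple arcs. A clique is a vertex set inducing a complete subgraph; it covers an edge if it contains both ends. For a maximal clique $C$ of $G$, an edge is occupied by $C$ if $C$ is the only maximal clique of $G$ covering it. The competition graph $C(D)$ of a digraph $D$ has vertex set $V(D)$, and distinct $x,y$ are adjacent iff some $z$ has arcs $(x,z),(y,z)$ in $D$. The competition number $k(G)$ is the smallest $k\ge0$ such that $G$ together with $k$ new isolated vertices is the competition graph of an acyclic digraph. An edge clique cover is a family of cliques covering all edges; $\theta_e(G)$ is the minimum size of one; a minimum edge clique cover has size $\theta_e(G)$. For $G$ with at least one edge, a minimum edge clique cover $\mathcal{C}=\{C_1,\dots,C_{\theta_e(G)}\}$ is an effective competition cover if every $C_i$ is a maximal clique and there is an acyclic digraph $D$ whose competition graph is $G$ together with $k(G)$ isolated vertices, such that the set of vertices of nonzero in-degree of $D$ is $\{w_1,\dots,w_{\theta_e(G)}\}$ where each $w_i$ is a common out-neighbor of all vertices of $C_i$. *)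

theory Defs
  imports "Graph_Theory.Pair_Digraph"
begin

text \<open>
  A finite simple graph is a \<^locale>\<open>pair_graph\<close>: finite, loop-free, with a symmetric arc set, so that
  an edge \<open>uv\<close> is the pair of arcs \<open>(u, v)\<close> and \<open>(v, u)\<close>. A finite digraph without loops or
  multiple arcs is a \<^locale>\<open>pair_digraph\<close>.
\<close>

definition clique :: "'a pair_pre_digraph \<Rightarrow> 'a set \<Rightarrow> bool" where
  "clique G C \<longleftrightarrow> C \<subseteq> pverts G \<and> (\<forall>u\<in>C. \<forall>v\<in>C. u \<noteq> v \<longrightarrow> (u, v) \<in> parcs G)"

definition maximal_clique :: "'a pair_pre_digraph \<Rightarrow> 'a set \<Rightarrow> bool" where
  "maximal_clique G C \<longleftrightarrow> clique G C \<and> (\<forall>C'. clique G C' \<longrightarrow> C \<subseteq> C' \<longrightarrow> C' = C)"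

definition covers :: "'a set \<Rightarrow> 'a \<times> 'a \<Rightarrow> bool" where
  "covers C e \<longleftrightarrow> fst e \<in> C \<and> snd e \<in> C"

definition occupied_by :: "'a pair_pre_digraph \<Rightarrow> 'a \<times> 'a \<Rightarrow> 'a set \<Rightarrow> bool" where
  "occupied_by G e C \<longleftrightarrow>
     e \<in> parcs G \<and> maximal_clique G C \<and> covers C e \<and>
     (\<forall>C'. maximal_clique G C' \<longrightarrow> covers C' e \<longrightarrow> C' = C)"

definition competition_graph :: "'a pair_pre_digraph \<Rightarrow> 'a pair_pre_digraph" where
  "competition_graph D =
     \<lparr> pverts = pverts D,
       parcs = {(x, y). x \<in> pverts D \<and> y \<in> pverts D \<and> x \<noteq> y \<and>
                  (\<exists>z\<in>pverts D. (x, z) \<in> parcs D \<and> (y, z) \<in> parcs D)} \<rparr>"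

text \<open>The new vertices are \<open>Inr 0, \<dots>, Inr (k - 1)\<close>; the sum type makes them distinct from those of \<open>G\<close>.\<close>

definition add_isolated :: "'a pair_pre_digraph \<Rightarrow> nat \<Rightarrow> ('a + nat) pair_pre_digraph" where
  "add_isolated G k =
     \<lparr> pverts = Inl ` pverts G \<union> Inr ` {..<k},
       parcs = {(Inl u, Inl v) | u v. (u, v) \<in> parcs G} \<rparr>"

definition acyclic_digraph :: "'a pair_pre_digraph \<Rightarrow> bool" where
  "acyclic_digraph D \<longleftrightarrow> pair_digraph D \<and> acyclic (parcs D)"

definition competition_number :: "'a pair_pre_digraph \<Rightarrow> nat" where
  "competition_number G =
     (LEAST k. \<exists>D. acyclic_digraph D \<and> competition_graph D = add_isolated G k)"

definition edge_clique_cover :: "'a pair_pre_digraph \<Rightarrow> 'a set set \<Rightarrow> bool" where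
  "edge_clique_cover G \<C> \<longleftrightarrow>
     (\<forall>C\<in>\<C>. clique G C) \<and> (\<forall>e\<in>parcs G. \<exists>C\<in>\<C>. covers C e)"

definition edge_clique_cover_number :: "'a pair_pre_digraph \<Rightarrow> nat" where
  "edge_clique_cover_number G = (LEAST n. \<exists>\<C>. edge_clique_cover G \<C> \<and> card \<C> = n)"

definition minimum_edge_clique_cover :: "'a pair_pre_digraph \<Rightarrow> 'a set set \<Rightarrow> bool" where
  "minimum_edge_clique_cover G \<C> \<longleftrightarrow>
     edge_clique_cover G \<C> \<and> card \<C> = edge_clique_cover_number G"

text \<open>
  The members of a minimum edge clique cover are distinct, so the indexed vertices \<open>w\<^sub>i\<close> are given by
  a function of the cliques \<open>C\<^sub>i\<close> themselves.
\<close>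

definition effective_competition_cover :: "'a pair_pre_digraph \<Rightarrow> 'a set set \<Rightarrow> bool" where
  "effective_competition_cover G \<C> \<longleftrightarrow>
     parcs G \<noteq> {} \<and>
     minimum_edge_clique_cover G \<C> \<and>
     (\<forall>C\<in>\<C>. maximal_clique G C) \<and>
     (\<exists>D w. acyclic_digraph D \<and>
        competition_graph D = add_isolated G (competition_number G) \<and>
        {v \<in> pverts D. in_degree (with_proj D) v \<noteq> 0} = w ` \<C> \<and>
        (\<forall>C\<in>\<C>. \<forall>x\<in>C. (Inl x, w C) \<in> parcs D))"

text \<open>The two minima above are attained.\<close>

lemma competition_number_attained:
  assumes "pair_graph G"
  shows "\<exists>D. acyclic_digraph D \<and> competition_graph D = add_isolated G (competition_number G)"
proof -
  interpret pair_graph G by fact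
  obtain f :: "'a \<times> 'a \<Rightarrow> nat" and n where f: "f ` parcs G = {i. i < n}" "inj_on f (parcs G)"
    using finite_imp_inj_to_nat_seg[OF pair_finite_arcs] by metis
  define A where "A = (\<lambda>e. (Inl (fst e) :: 'a + nat, Inr (f e) :: 'a + nat)) ` parcs G
    \<union> (\<lambda>e. (Inl (snd e), Inr (f e))) ` parcs G"
  define D where "D = \<lparr> pverts = Inl ` pverts G \<union> Inr ` {..<n}, parcs = A \<rparr>"
  have fin: "finite A" unfolding A_def using pair_finite_arcs by simp
  have arcD: "\<exists>u e. p = (Inl u, Inr (f e)) \<and> e \<in> parcs G \<and> (u = fst e \<or> u = snd e)"
    if "p \<in> A" for p using that unfolding A_def by blast
  have wf: "fst p \<in> pverts D \<and> snd p \<in> pverts D \<and> fst p \<noteq> snd p" if pD: "p \<in> parcs D" for p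
  proof -
    obtain u e where u: "p = (Inl u, Inr (f e))" "e \<in> parcs G" "u = fst e \<or> u = snd e"
      using arcD[of p] pD unfolding D_def by auto
    have "u \<in> pverts G" using u(2,3) arc_fst_in_verts arc_snd_in_verts by blast
    moreover have "f e < n" using f(1) u(2) by blast
    ultimately show ?thesis using u(1) unfolding D_def by simp
  qed
  have "pair_digraph D"
    using wf fin pair_finite_verts by unfold_locales (auto simp: D_def)
  moreover have "acyclic (parcs D)"
  proof (rule acyclicI, rule allI, rule notI)
    fix x assume "(x, x) \<in> (parcs D)\<^sup>+"
    then obtain y z where "(x, y) \<in> parcs D" "(z, x) \<in> parcs D"
      by (meson tranclD tranclD2)
    hence "(x, y) \<in> A" "(z, x) \<in> A" unfolding D_def by simp_all
    from arcD[OF this(1)] arcD[OF this(2)] show False by auto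
  qed
  moreover have "competition_graph D = add_isolated G n"
  proof -
    have "parcs (competition_graph D) = parcs (add_isolated G n)" (is "?L = ?R")
    proof (intro set_eqI iffI)
      fix p assume "p \<in> ?L"
      then obtain x y z where p: "p = (x, y)" "x \<noteq> y" "(x, z) \<in> A" "(y, z) \<in> A"
        unfolding competition_graph_def D_def by auto
      obtain u e where u: "x = Inl u" "z = Inr (f e)" "e \<in> parcs G" "u = fst e \<or> u = snd e"
        using arcD[OF p(3)] by auto
      obtain v e' where v: "y = Inl v" "z = Inr (f e')" "e' \<in> parcs G" "v = fst e' \<or> v = snd e'"
        using arcD[OF p(4)] by auto
      have "e' = e" using f(2) u v by (auto dest: inj_onD)
      hence "(u, v) \<in> parcs G"
        using u v p(2) arcs_symmetric by (cases e) auto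
      thus "p \<in> ?R" using p(1) u v unfolding add_isolated_def by auto
    next
      fix p assume "p \<in> ?R"
      then obtain u v where p: "p = (Inl u, Inl v)" and uv: "(u, v) \<in> parcs G"
        unfolding add_isolated_def by auto
      have a: "(Inl u, Inr (f (u, v))) \<in> A" "(Inl v, Inr (f (u, v))) \<in> A"
        unfolding A_def using imageI[OF uv, of "\<lambda>e. (Inl (fst e) :: 'a + nat, Inr (f e) :: 'a + nat)"]
          imageI[OF uv, of "\<lambda>e. (Inl (snd e) :: 'a + nat, Inr (f e) :: 'a + nat)"] by simp_all
      have "u \<noteq> v" using pair_no_loops[OF uv] by simp
      thus "p \<in> ?L"
        using a wf[of "(Inl u, Inr (f (u, v)))"] wf[of "(Inl v, Inr (f (u, v)))"]
        unfolding p competition_graph_def D_def by auto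
    qed
    thus ?thesis by (simp add: competition_graph_def add_isolated_def D_def)
  qed
  ultimately have "\<exists>D. acyclic_digraph D \<and> competition_graph D = add_isolated G n"
    unfolding acyclic_digraph_def by blast
  thus ?thesis unfolding competition_number_def
    by (rule LeastI[where P = "\<lambda>k. \<exists>D. acyclic_digraph D \<and> competition_graph D = add_isolated G k"])
qed

lemma minimum_edge_clique_cover_exists:
  assumes "pair_graph G"
  shows "\<exists>\<C>. minimum_edge_clique_cover G \<C>"
proof -
  interpret pair_graph G by fact
  have "edge_clique_cover G ((\<lambda>e. {fst e, snd e}) ` parcs G)"
    unfolding edge_clique_cover_def clique_def covers_def
    using arc_fst_in_verts arc_snd_in_verts by (auto intro: arcs_symmetric in_arcsD1 in_arcsD2)
  hence "\<exists>\<C>. edge_clique_cover G \<C> \<and> card \<C> = card ((\<lambda>e. {fst e, snd e}) ` parcs G)" by blast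
  hence "\<exists>\<C>. edge_clique_cover G \<C> \<and> card \<C> = edge_clique_cover_number G"
    unfolding edge_clique_cover_number_def
    by (rule LeastI[where P = "\<lambda>n. \<exists>\<C>. edge_clique_cover G \<C> \<and> card \<C> = n"])
  thus ?thesis unfolding minimum_edge_clique_cover_def .
qed

end

theory Submission
  imports Defs
begin

text \<open>
  Every edge clique cover contains, for each maximal clique \<open>C\<close>, a clique covering an edge occupied by
  \<open>C\<close>; that clique lies in \<open>C\<close>, so the family of all maximal cliques is a minimum cover.

  Take an acyclic digraph \<open>D\<close> realising \<open>k(G)\<close>, with a topological numbering. An in-neighbourhood
  covering an edge occupied by \<open>C\<close> is contained in \<open>C\<close>, and by hypothesis every vertex of \<open>C\<close> occurs in
  one of them. Among the vertices having such an in-neighbourhood let \<open>w C\<close> be the last one: it comes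
  after all vertices of \<open>C\<close>. The digraph with arcs from all of \<open>C\<close> to \<open>w C\<close>, for each maximal clique
  \<open>C\<close>, is therefore acyclic, and \<open>w\<close> is injective, so its competition graph is unchanged.
\<close>

section \<open>Topological numberings of acyclic digraphs\<close>

text \<open>Number each vertex by how many vertices reach it by a nonempty path. Along an arc from
  \<open>x\<close> to \<open>y\<close> this set gains at least \<open>x\<close>, which by acyclicity
  does not reach itself.\<close>

lemma finite_acyclic_topological_numbering:
  assumes "finite r" "acyclic r"
  obtains f :: "'b \<Rightarrow> nat" where "\<And>x y. (x, y) \<in> r \<Longrightarrow> f x < f y"
proof
  fix x y assume xy: "(x, y) \<in> r"
  have "finite {z. (z, y) \<in> r\<^sup>+}"
    by (rule finite_subset[of _ "fst ` (r\<^sup>+)"]) (use assms(1) in \<open>force+\<close>)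
  moreover have "{z. (z, x) \<in> r\<^sup>+} \<subset> {z. (z, y) \<in> r\<^sup>+}"
    using xy assms(2) unfolding acyclic_def by (auto intro: trancl_into_trancl)
  ultimately show "card {z. (z, x) \<in> r\<^sup>+} < card {z. (z, y) \<in> r\<^sup>+}"
    by (rule psubset_card_mono)
qed

lemma acyclic_if_increasing:
  fixes f :: "'b \<Rightarrow> nat"
  assumes "\<And>x y. (x, y) \<in> r \<Longrightarrow> f x < f y"
  shows "acyclic r"
proof (rule acyclicI, intro allI notI)
  have inc: "f x < f y" if "(x, y) \<in> r\<^sup>+" for x y
    using that by induction (auto dest: assms)
  fix x assume "(x, x) \<in> r\<^sup>+"
  with inc show False by blast
qed

section \<open>Maximal cliques and occupied edges\<close>

lemma clique_extends_to_maximal: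
  assumes "finite (pverts G)" "clique G K"
  obtains C where "maximal_clique G C" "K \<subseteq> C"
proof -
  have "finite {C. clique G C}"
    by (rule finite_subset[of _ "Pow (pverts G)"]) (use assms(1) in \<open>auto simp: clique_def\<close>)
  then obtain C where "clique G C" "K \<subseteq> C" "\<And>C'. clique G C' \<Longrightarrow> C \<subseteq> C' \<Longrightarrow> C' = C"
    using finite_has_maximal2[of "{C. clique G C}" K] assms(2) by auto
  then show thesis using that unfolding maximal_clique_def by blast
qed

text \<open>A maximal clique extending \<open>K\<close> still covers \<open>e\<close>, so occupation
  forces it to be \<open>C\<close>.\<close>

lemma clique_covering_occupied_subset:
  assumes "finite (pverts G)" "occupied_by G e C" "clique G K" "covers K e"
  shows "K \<subseteq> C"
proof -
  obtain C' where C': "maximal_clique G C'" "K \<subseteq> C'"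
    using clique_extends_to_maximal assms(1,3) by blast
  then have "covers C' e" using assms(4) unfolding covers_def by auto
  then show ?thesis using C' assms(2) unfolding occupied_by_def by auto
qed

lemma edge_covered_by_maximal_clique:
  assumes "pair_graph G" "e \<in> parcs G"
  obtains C where "maximal_clique G C" "covers C e"
proof -
  interpret pair_graph G by fact
  have "clique G {fst e, snd e}"
    using assms(2) arc_fst_in_verts arc_snd_in_verts
    unfolding clique_def by (cases e) (auto intro: arcs_symmetric in_arcsD1 in_arcsD2)
  then obtain C where "maximal_clique G C" "{fst e, snd e} \<subseteq> C"
    using clique_extends_to_maximal pair_finite_verts by blast
  then show thesis using that unfolding covers_def by auto
qed

lemma maximal_cliques_minimum_cover:
  assumes G: "pair_graph G"
    and occ: "\<And>C. maximal_clique G C \<Longrightarrow> \<exists>e. occupied_by G e C"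
  shows "minimum_edge_clique_cover G {C. maximal_clique G C}"
proof -
  interpret pair_graph G by fact
  let ?M = "{C. maximal_clique G C}"
  have cover: "edge_clique_cover G ?M"
    unfolding edge_clique_cover_def
  proof (intro conjI ballI)
    show "clique G C" if "C \<in> ?M" for C
      using that unfolding maximal_clique_def by simp
    show "\<exists>C\<in>?M. covers C e" if "e \<in> parcs G" for e
      by (rule edge_covered_by_maximal_clique[OF G that]) blast
  qed
  have le: "card ?M \<le> card \<F>" if F: "edge_clique_cover G \<F>" for \<F>
  proof -
    \<comment> \<open>An infinite family would have \<open>card\<close> 0, so the bound depends on
      this.\<close>
    have fin: "finite \<F>"
      by (rule finite_subset[of _ "Pow (pverts G)"])
        (use F in \<open>auto simp: edge_clique_cover_def clique_def\<close>)
    obtain e where e: "\<And>C. maximal_clique G C \<Longrightarrow> occupied_by G (e C) C"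
      using occ by metis
    have "\<forall>C\<in>?M. \<exists>K\<in>\<F>. covers K (e C)"
      using F e unfolding edge_clique_cover_def occupied_by_def by blast
    then obtain g where g: "\<And>C. maximal_clique G C \<Longrightarrow> g C \<in> \<F> \<and> covers (g C) (e C)"
      by (metis mem_Collect_eq)
    have sub: "g C \<subseteq> C" if "maximal_clique G C" for C
      using clique_covering_occupied_subset[OF pair_finite_verts e[OF that]] g[OF that] F
      unfolding edge_clique_cover_def by blast
    \<comment> \<open>If \<open>C\<close> and \<open>C'\<close> share the value of \<open>g\<close>,
      that set lies inside \<open>C'\<close> and covers \<open>e C\<close>, an edge that only
      \<open>C\<close> covers among maximal cliques.\<close>
    have "inj_on g ?M"
    proof (rule inj_onI)
      fix C C' assume CC: "C \<in> ?M" "C' \<in> ?M" "g C = g C'"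
      then have "covers C' (e C)"
        using sub[of C'] g[of C] unfolding covers_def by auto
      then show "C = C'" using e[of C] CC unfolding occupied_by_def by auto
    qed
    then show ?thesis using card_inj_on_le[of g ?M \<F>] g fin by blast
  qed
  show ?thesis
    unfolding minimum_edge_clique_cover_def edge_clique_cover_number_def
    using cover le by (auto intro!: Least_equality[symmetric])
qed

section \<open>Rebuilding the digraph from maximal cliques\<close>

text \<open>Two in-neighbours of \<open>z\<close> compete for it, and \<open>add_isolated\<close>
  adds no arcs, so their adjacency comes from \<open>G\<close>.\<close>

lemma competition_in_neighbours_clique:
  assumes G: "pair_graph G" and D: "pair_digraph D"
    and comp: "competition_graph D = add_isolated G k"
    and zuv: "u \<noteq> v" "(Inl u, z) \<in> parcs D" "(Inl v, z) \<in> parcs D"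
  shows "clique G {x. (Inl x, z) \<in> parcs D}"
proof -
  interpret D: pair_digraph D by fact
  have arc: "(x, y) \<in> parcs G"
    if "x \<noteq> y" "(Inl x, z) \<in> parcs D" "(Inl y, z) \<in> parcs D" for x y
  proof -
    have "(Inl x, Inl y) \<in> parcs (competition_graph D)"
      using that D.in_arcsD1 D.in_arcsD2 unfolding competition_graph_def by auto
    then show ?thesis unfolding comp add_isolated_def by auto
  qed
  have "pverts D = pverts (add_isolated G k)"
    using comp[symmetric] by (simp add: competition_graph_def)
  then have "x \<in> pverts G" if "(Inl x, z) \<in> parcs D" for x
    using D.in_arcsD1[OF that] by (auto simp: add_isolated_def)
  with arc show ?thesis unfolding clique_def by auto
qed

text \<open>Only the arcs of \<open>D\<close> are replaced; the vertex set stays, so the same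
  \<open>k\<close> new vertices suffice, and in particular the optimal number of them.\<close>

lemma realise_by_maximal_cliques:
  fixes D :: "('a + nat) pair_pre_digraph"
  assumes G: "pair_graph G"
    and occ: "\<And>C v. maximal_clique G C \<Longrightarrow> v \<in> C \<Longrightarrow>
           \<exists>e. occupied_by G e C \<and> (v = fst e \<or> v = snd e)"
    and ne: "{} \<notin> {C. maximal_clique G C}"
    and acy: "acyclic_digraph D"
    and comp: "competition_graph D = add_isolated G k"
  obtains D' w where "acyclic_digraph D'" "competition_graph D' = add_isolated G k"
    "parcs D' = {(Inl x, w C) | x C. maximal_clique G C \<and> x \<in> C}"
    "w ` {C. maximal_clique G C} \<subseteq> pverts D'"
proof -
  interpret pair_graph G by fact
  interpret D: pair_digraph D using acy unfolding acyclic_digraph_def by blast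
  have vD: "pverts D = Inl ` pverts G \<union> Inr ` {..<k}"
    using arg_cong[OF comp, of pverts] by (simp add: competition_graph_def add_isolated_def)
  obtain f :: "'a + nat \<Rightarrow> nat" where f: "\<And>x y. (x, y) \<in> parcs D \<Longrightarrow> f x < f y"
    using finite_acyclic_topological_numbering[OF D.pair_finite_arcs] acy
    unfolding acyclic_digraph_def by blast
  define Z where "Z C = {z \<in> pverts D. \<exists>e. occupied_by G e C \<and>
      (Inl (fst e), z) \<in> parcs D \<and> (Inl (snd e), z) \<in> parcs D}" for C
  have edge: "\<exists>z\<in>Z C. (Inl (fst e), z) \<in> parcs D \<and> (Inl (snd e), z) \<in> parcs D"
    if "occupied_by G e C" for e C
  proof -
    have "(Inl (fst e), Inl (snd e)) \<in> parcs (competition_graph D)"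
      using that unfolding comp add_isolated_def occupied_by_def by auto
    then obtain z where "z \<in> pverts D" "(Inl (fst e), z) \<in> parcs D" "(Inl (snd e), z) \<in> parcs D"
      unfolding competition_graph_def by auto
    then show ?thesis using that unfolding Z_def by blast
  qed
  have Zne: "Z C \<noteq> {}" if "maximal_clique G C" for C
  proof -
    have "C \<noteq> {}" using that ne by auto
    then obtain v where "v \<in> C" by auto
    then show ?thesis using occ[OF that] edge by blast
  qed
  have Zfin: "finite (Z C)" for C unfolding Z_def by simp
  have "\<exists>z\<in>Z C. \<forall>z'\<in>Z C. f z' \<le> f z" if "maximal_clique G C" for C
  proof -
    have "Max (f ` Z C) \<in> f ` Z C" using Zfin Zne[OF that] by simp
    then obtain z where "z \<in> Z C" "f z = Max (f ` Z C)" by auto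
    then show ?thesis using Zfin by (metis Max_ge finite_imageI imageI)
  qed
  then obtain w where w_in: "\<And>C. maximal_clique G C \<Longrightarrow> w C \<in> Z C"
    and w_max: "\<And>C z. maximal_clique G C \<Longrightarrow> z \<in> Z C \<Longrightarrow> f z \<le> f (w C)"
    by metis
  \<comment> \<open>The in-neighbourhood in \<open>D\<close> of the shared vertex is a clique
    covering an edge occupied by \<open>C'\<close>, hence inside \<open>C'\<close>. It also covers
    an edge occupied by \<open>C\<close>, which \<open>C'\<close> therefore covers too.\<close>
  have w_inj: "C = C'" if CC: "maximal_clique G C" "maximal_clique G C'" "w C = w C'" for C C'
  proof -
    let ?N = "{x. (Inl x, w C) \<in> parcs D}"
    obtain e where e: "occupied_by G e C" "covers ?N e"
      using w_in[OF CC(1)] unfolding Z_def covers_def by blast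
    obtain e' where e': "occupied_by G e' C'" "covers ?N e'"
      using w_in[OF CC(2)] unfolding Z_def covers_def CC(3) by blast
    have "fst e \<noteq> snd e" using e(1) no_loops unfolding occupied_by_def by auto
    then have "clique G ?N"
      using competition_in_neighbours_clique[OF G D.pair_digraph_axioms comp] e(2)
      unfolding covers_def by auto
    then have "?N \<subseteq> C'"
      using clique_covering_occupied_subset[OF pair_finite_verts e'(1)] e'(2) by blast
    then have "covers C' e" using e(2) unfolding covers_def by auto
    then show ?thesis using e(1) CC(2) unfolding occupied_by_def by auto
  qed
  define D' where "D' = \<lparr> pverts = pverts D,
      parcs = {(Inl x, w C) | x C. maximal_clique G C \<and> x \<in> C} \<rparr>"
  have wv: "w C \<in> pverts D" if "maximal_clique G C" for C
    using w_in[OF that] unfolding Z_def by auto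
  have xv: "Inl x \<in> pverts D" if "maximal_clique G C" "x \<in> C" for C x
    using that unfolding vD maximal_clique_def clique_def by auto
  \<comment> \<open>The old numbering still works: \<open>x\<close> is an end of an edge occupied by
    \<open>C\<close>, so it has an out-neighbour in \<open>Z C\<close>, and \<open>w C\<close> comes
    no earlier than that.\<close>
  have inc: "f p < f q" if pq: "(p, q) \<in> parcs D'" for p q
  proof -
    obtain x C where x: "p = Inl x" "q = w C" "maximal_clique G C" "x \<in> C"
      using pq unfolding D'_def by auto
    obtain z where "z \<in> Z C" "(Inl x, z) \<in> parcs D"
      using occ[OF x(3,4)] edge by blast
    then show ?thesis using f[of "Inl x" z] w_max[OF x(3)] x(1,2) by fastforce
  qed
  have sub: "parcs D' \<subseteq> pverts D' \<times> pverts D'"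
    using wv xv unfolding D'_def by auto
  have "finite (parcs D')"
    by (rule finite_subset[OF sub]) (simp add: D'_def)
  then have "pair_digraph D'"
    using sub inc by unfold_locales (force simp: D'_def)+
  then have "acyclic_digraph D'"
    using acyclic_if_increasing[of "parcs D'" f] inc unfolding acyclic_digraph_def by blast
  moreover have "competition_graph D' = add_isolated G k"
  proof -
    have "parcs (competition_graph D') = parcs (add_isolated G k)" (is "?L = ?R")
    proof (intro set_eqI iffI)
      fix p assume "p \<in> ?L"
      then obtain x y C C' where p: "p = (Inl x, Inl y)" "x \<noteq> y" "maximal_clique G C" "x \<in> C"
        "maximal_clique G C'" "y \<in> C'" "w C = w C'"
        unfolding competition_graph_def D'_def by auto
      \<comment> \<open>Injectivity of \<open>w\<close> puts both ends into the same clique.\<close>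
      then have "(x, y) \<in> parcs G"
        using w_inj[of C C'] unfolding maximal_clique_def clique_def by auto
      then show "p \<in> ?R" using p(1) unfolding add_isolated_def by auto
    next
      fix p assume "p \<in> ?R"
      then obtain x y where p: "p = (Inl x, Inl y)" and xy: "(x, y) \<in> parcs G"
        unfolding add_isolated_def by auto
      obtain C where "maximal_clique G C" "x \<in> C" "y \<in> C"
        using edge_covered_by_maximal_clique[OF G xy] unfolding covers_def by auto
      moreover have "x \<noteq> y" using pair_no_loops[OF xy] by simp
      ultimately show "p \<in> ?L"
        using p wv xv unfolding competition_graph_def D'_def by auto
    qed
    then show ?thesis
      using vD by (simp add: competition_graph_def add_isolated_def D'_def)
  qed
  ultimately show thesis
    using that[of D' w] wv unfolding D'_def by auto
qed

section \<open>In-degrees and the effective cover\<close>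

text \<open>The in-degree is a \<open>card\<close>, so finiteness of the arc set is what separates 0
  from the value for an infinite set.\<close>

lemma in_degree_nonzero_iff:
  assumes "pair_digraph D"
  shows "in_degree (with_proj D) v \<noteq> 0 \<longleftrightarrow> (\<exists>u. (u, v) \<in> parcs D)"
proof -
  interpret pair_digraph D by fact
  have "finite (in_arcs (with_proj D) v)"
    by (rule finite_subset[OF _ pair_finite_arcs]) (auto simp: in_arcs_def)
  then show ?thesis unfolding in_degree_def by (auto simp: in_arcs_def)
qed

theorem theorem2p4:
  fixes G :: "'a pair_pre_digraph"
  assumes "pair_graph G"
    and "parcs G \<noteq> {}"
    and "\<And>C v. maximal_clique G C \<Longrightarrow> v \<in> C \<Longrightarrow>
           \<exists>e. occupied_by G e C \<and> (v = fst e \<or> v = snd e)"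
  shows "\<exists>\<C>. effective_competition_cover G \<C>"
proof -
  interpret pair_graph G by fact
  let ?M = "{C. maximal_clique G C}"
  \<comment> \<open>An edge provides a vertex, whose singleton is a clique strictly above the empty
    one.\<close>
  obtain a b where "(a, b) \<in> parcs G" using assms(2) by auto
  then have "clique G {a}" using in_arcsD1 unfolding clique_def by auto
  then have ne: "{} \<notin> ?M" unfolding maximal_clique_def by auto
  have "\<exists>e. occupied_by G e C" if "maximal_clique G C" for C
  proof -
    have "C \<noteq> {}" using that ne by auto
    then show ?thesis using assms(3)[OF that] by blast
  qed
  then have min: "minimum_edge_clique_cover G ?M"
    using maximal_cliques_minimum_cover[OF assms(1)] by blast
  obtain D\<^sub>0 where D\<^sub>0: "acyclic_digraph D\<^sub>0"
    "competition_graph D\<^sub>0 = add_isolated G (competition_number G)"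
    using competition_number_attained[OF assms(1)] by blast
  obtain D w where D: "acyclic_digraph D"
    "competition_graph D = add_isolated G (competition_number G)"
    "parcs D = {(Inl x, w C) | x C. maximal_clique G C \<and> x \<in> C}"
    "w ` ?M \<subseteq> pverts D"
    by (rule realise_by_maximal_cliques[OF assms(1,3) ne D\<^sub>0])
  have "pair_digraph D" using D(1) unfolding acyclic_digraph_def by blast
  note in_degree = in_degree_nonzero_iff[OF this]
  \<comment> \<open>Nonemptiness of \<open>C\<close> gives \<open>w C\<close> an incoming arc;
    conversely, every arc of \<open>D\<close> ends at some \<open>w C\<close>.\<close>
  have "w C \<in> {v \<in> pverts D. in_degree (with_proj D) v \<noteq> 0}" if C: "maximal_clique G C" for C
  proof -
    obtain x where "x \<in> C" using C ne by (cases "C = {}") auto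
    then show ?thesis using C D(4) unfolding in_degree D(3) by blast
  qed
  then have "{v \<in> pverts D. in_degree (with_proj D) v \<noteq> 0} = w ` ?M"
    unfolding in_degree D(3) by blast
  then have "effective_competition_cover G ?M"
    unfolding effective_competition_cover_def using assms(2) min D by blast
  then show ?thesis by blast
qed

end
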